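(* Let $R$ be a reduced ring which is rr-good. Then the support in the Pierce sheaf of each $a\in R$ is clopen in $\operatorname{Spec}\mathbf{B}(R)$, and each Pierce stalk $R_x$, $x\in\operatorname{Spec}\mathbf{B}(R)$, is rr-good.
   Context: Rings are associative with $1$, not necessarily commutative; a ring is reduced if it has no nonzero nilpotent elements. On a reduced ring $R$ the rr-order is the partial order $a\le_{\mathrm{rr}} b \iff a^2=ab$. A reduced ring is rr-good if every pair of its elements has an infimum (greatest lower bound) in the rr-order. All idempotents of a reduced ring $R$ are central; $\mathbf{B}(R)$ denotes the boolean algebra of idempotents of $R$ and $\operatorname{Spec}\mathbf{B}(R)$ is its space of prime (equivalently maximal) ideals with the usual (Stone) topology, which is compact, Hausdorff and totally disconnected. For $x\in\operatorname{Spec}\mathbf{B}(R)$, $Rx$ is the ideal of $R$ generated by $x$; the Pierce stalk at $x$ is $R_x=R/Rx$ (again a reduced ring) and $r_x=r+Rx$ for $r\in R$. The support of $a\in R$ is $\operatorname{supp} a=\{x\in\operatorname{Spec}\mathbf{B}(R)\mid a_x\neq 0_x\}$. Clopen means both open and closed. *)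

theory Defs
  imports "HOL-Algebra.QuotRing" "HOL-Analysis.Abstract_Topology"
begin

locale reduced_ring = ring +
  assumes nilpotent_zero: "\<lbrakk>a \<in> carrier R; 0 < n; a [^] (n::nat) = \<zero>\<rbrakk> \<Longrightarrow> a = \<zero>"

definition rr_order :: "('a, 'b) ring_scheme \<Rightarrow> 'a gorder" where
  "rr_order R =
    \<lparr>carrier = carrier R, eq = (=), le = (\<lambda>a b. a \<otimes>\<^bsub>R\<^esub> a = a \<otimes>\<^bsub>R\<^esub> b)\<rparr>"

locale rr_good_ring = reduced_ring +
  assumes rr_inf_exists:
    "\<lbrakk>a \<in> carrier R; b \<in> carrier R\<rbrakk>
      \<Longrightarrow> \<exists>c. greatest (rr_order R) c (Lower (rr_order R) {a, b})"

text \<open>The boolean algebra of (central) idempotents, encoded as a boolean ring: meet is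
  multiplication, and addition is symmetric difference \<open>e + f - 2ef\<close>. Its ideals and prime
  ideals are those of the boolean algebra. Centrality of the idempotents is not part of the
  carrier; it is automatic in a reduced ring.\<close>

definition idem_ring :: "('a, 'b) ring_scheme \<Rightarrow> 'a ring" where
  "idem_ring R =
    \<lparr>carrier = {e \<in> carrier R. e \<otimes>\<^bsub>R\<^esub> e = e}, mult = mult R, one = \<one>\<^bsub>R\<^esub>, zero = \<zero>\<^bsub>R\<^esub>,
     add = (\<lambda>e f. (e \<oplus>\<^bsub>R\<^esub> f) \<ominus>\<^bsub>R\<^esub> (e \<otimes>\<^bsub>R\<^esub> f \<oplus>\<^bsub>R\<^esub> e \<otimes>\<^bsub>R\<^esub> f))\<rparr>"

definition SpecB :: "('a, 'b) ring_scheme \<Rightarrow> 'a set set" where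
  "SpecB R = {x. primeideal x (idem_ring R)}"

text \<open>The topology whose basic open sets are \<open>{x. e \<notin> x}\<close> for idempotents \<open>e\<close>; taking \<open>e = 1\<close>
  shows that the underlying space is \<open>SpecB R\<close>.\<close>

definition SpecB_topology :: "('a, 'b) ring_scheme \<Rightarrow> 'a set topology" where
  "SpecB_topology R =
    topology_generated_by ((\<lambda>e. {x \<in> SpecB R. e \<notin> x}) ` carrier (idem_ring R))"

definition pierce_ideal :: "('a, 'b) ring_scheme \<Rightarrow> 'a set \<Rightarrow> 'a set" where
  "pierce_ideal R x = Idl\<^bsub>R\<^esub> x"

definition pierce_stalk :: "('a, 'b) ring_scheme \<Rightarrow> 'a set \<Rightarrow> 'a set ring" where
  "pierce_stalk R x = R Quot (pierce_ideal R x)"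

definition germ :: "('a, 'b) ring_scheme \<Rightarrow> 'a set \<Rightarrow> 'a \<Rightarrow> 'a set" where
  "germ R x r = pierce_ideal R x +>\<^bsub>R\<^esub> r"

definition pierce_supp :: "('a, 'b) ring_scheme \<Rightarrow> 'a \<Rightarrow> 'a set set" where
  "pierce_supp R a = {x \<in> SpecB R. germ R x a \<noteq> \<zero>\<^bsub>pierce_stalk R x\<^esub>}"

context reduced_ring
begin

lemma square_zero: "\<lbrakk>t \<in> carrier R; t \<otimes> t = \<zero>\<rbrakk> \<Longrightarrow> t = \<zero>"
  using nilpotent_zero[of t 2] by (simp add: numeral_2_eq_2)

lemma idem_central:
  assumes e: "e \<in> carrier R" "e \<otimes> e = e" and r: "r \<in> carrier R"
  shows "e \<otimes> r = r \<otimes> e"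
proof -
  define s t where "s = e \<otimes> r \<oplus> \<ominus> (e \<otimes> r \<otimes> e)" and "t = r \<otimes> e \<oplus> \<ominus> (e \<otimes> r \<otimes> e)"
  have car: "s \<in> carrier R" "t \<in> carrier R"
    using e r by (auto simp: s_def t_def)
  have er: "e \<otimes> (e \<otimes> u) = e \<otimes> u" if "u \<in> carrier R" for u
    using e that by (simp flip: m_assoc)
  have st: "s \<otimes> e = \<zero>" "e \<otimes> s = s" "e \<otimes> t = \<zero>" "t \<otimes> e = t"
    unfolding s_def t_def using e r er
    by (simp_all add: l_distr r_distr l_minus r_minus m_assoc r_neg)
  have "s \<otimes> s = \<zero>"
    using m_assoc[OF car(1) e(1) car(1)] l_null[OF car(1)] unfolding st by (rule trans[OF sym])
  moreover have "t \<otimes> t = \<zero>"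
    using m_assoc[OF car(2) e(1) car(2)] r_null[OF car(2)] unfolding st by (rule trans)
  ultimately have "s = \<zero>" "t = \<zero>"
    using square_zero car by blast+
  have eqI: "a = b" if "a \<oplus> \<ominus> b = \<zero>" "a \<in> carrier R" "b \<in> carrier R" for a b
    using minus_equality[OF that(1)] that by simp
  have "e \<otimes> r = e \<otimes> r \<otimes> e" "r \<otimes> e = e \<otimes> r \<otimes> e"
    using \<open>s = \<zero>\<close> \<open>t = \<zero>\<close> e(1) r unfolding s_def t_def by (blast intro: eqI)+
  then show ?thesis
    by (rule trans[OF _ sym])
qed

lemma idem_ring_cring: "cring (idem_ring R)"
proof -
  define B where "B = {e \<in> carrier R. e \<otimes> e = e}"
  define pl where "pl = (\<lambda>e f. (e \<oplus> f) \<ominus> (e \<otimes> f \<oplus> e \<otimes> f))"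
  have BI: "e \<in> B" if "e \<in> carrier R" "e \<otimes> e = e" for e
    using that by (simp add: B_def)
  have car: "e \<in> carrier R" if "e \<in> B" for e
    using that by (simp add: B_def)
  have id: "e \<otimes> e = e" if "e \<in> B" for e
    using that by (simp add: B_def)
  have comm: "e \<otimes> f = f \<otimes> e" if "e \<in> B" "f \<in> B" for e f
    using that idem_central by (auto simp: B_def)
  have lcomm: "e \<otimes> (f \<otimes> r) = f \<otimes> (e \<otimes> r)" if "e \<in> B" "f \<in> B" "r \<in> carrier R" for e f r
    using that by (metis car comm m_assoc)
  have lid: "e \<otimes> (e \<otimes> r) = e \<otimes> r" if "e \<in> B" "r \<in> carrier R" for e r
    using that by (metis car id m_assoc)
  have mB: "e \<otimes> f \<in> B" if "e \<in> B" "f \<in> B" for e f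
  proof -
    have "(e \<otimes> f) \<otimes> (e \<otimes> f) = e \<otimes> f"
      using that car by (simp add: m_assoc lcomm[of f e] lid id)
    with m_closed[OF car car, OF that] show ?thesis
      by (rule BI)
  qed
  have plB: "pl e f \<in> B" if ef: "e \<in> B" "f \<in> B" for e f
  proof -
    define p where "p = e \<otimes> f"
    define d where "d = pl e f"
    have cs: "e \<in> carrier R" "f \<in> carrier R" "p \<in> carrier R" "d \<in> carrier R"
      using ef car by (auto simp: p_def d_def pl_def)
    have d: "d = e \<oplus> f \<oplus> (\<ominus> p \<oplus> \<ominus> p)"
      using cs by (simp add: d_def pl_def p_def minus_eq minus_add)
    have "e \<otimes> p = p" "f \<otimes> p = p" "p \<otimes> e = p" "p \<otimes> f = p" "p \<otimes> p = p" "f \<otimes> e = p" "e \<otimes> f = p"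
      using ef car comm[of f e]
      by (simp_all add: p_def m_assoc lid lcomm[of f e e] lcomm[of f e f] id)
    note ps = this id[OF ef(1)] id[OF ef(2)]
    have "e \<otimes> d = e \<oplus> \<ominus> p" "f \<otimes> d = f \<oplus> \<ominus> p" "p \<otimes> d = \<zero>"
      unfolding d using cs ps by (simp_all add: r_distr r_minus a_ac r_neg r_neg1 r_neg2)
    moreover have "d \<otimes> d = e \<otimes> d \<oplus> f \<otimes> d \<oplus> (\<ominus> (p \<otimes> d) \<oplus> \<ominus> (p \<otimes> d))"
    proof -
      have "d \<otimes> d = (e \<oplus> f \<oplus> (\<ominus> p \<oplus> \<ominus> p)) \<otimes> d" by (simp flip: d)
      then show ?thesis using cs by (simp add: l_distr l_minus)
    qed
    ultimately have "d \<otimes> d = d"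
      using cs by (simp add: d a_ac)
    then show ?thesis
      using BI[OF cs(4)] by (simp add: d_def)
  qed
  have oz: "\<one> \<in> B" "\<zero> \<in> B"
    by (auto simp: B_def)
  have "cring \<lparr>carrier = B, mult = (\<otimes>), one = \<one>, zero = \<zero>, add = pl\<rparr>"
  proof (rule cringI, goal_cases)
    case 1
    show ?case
    proof (rule abelian_groupI; simp only: ring_record_simps)
      fix x y z assume xyz: "x \<in> B" "y \<in> B" "z \<in> B"
      note c = this[THEN car]
      show "pl (pl x y) z = pl x (pl y z)"
        using c xyz
        by (simp add: pl_def minus_eq minus_add l_distr r_distr l_minus r_minus m_assoc a_ac)
    next
      fix x y assume xy: "x \<in> B" "y \<in> B"
      then show "pl x y = pl y x"
        using comm[of x y] car by (simp add: pl_def a_comm)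
    next
      fix x assume x: "x \<in> B"
      then show "pl \<zero> x = x"
        using car by (simp add: pl_def minus_eq)
      have "pl x x = \<zero>"
        using x car[OF x] by (simp add: pl_def id minus_eq r_neg)
      then show "\<exists>y\<in>B. pl y x = \<zero>"
        using x by blast
    qed (use plB oz in auto)
  next
    case 2
    show ?case
    proof (rule comm_monoidI; simp only: ring_record_simps)
      fix x y assume "x \<in> B" "y \<in> B"
      then show "x \<otimes> y = y \<otimes> x"
        by (rule comm)
    qed (use mB oz car in \<open>auto simp: m_assoc\<close>)
  next
    case (3 x y z)
    then have xyz: "x \<in> B" "y \<in> B" "z \<in> B"
      by auto
    then show ?case
      using car by (simp add: pl_def minus_eq minus_add l_distr l_minus m_assoc comm[of z y]
          lcomm[of z y] id lid)
  qed
  then show ?thesis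
    by (simp add: idem_ring_def B_def pl_def)
qed

lemma topspace_SpecB: "topspace (SpecB_topology R) = SpecB R"
proof -
  have "\<one> \<in> carrier (idem_ring R)"
    by (simp add: idem_ring_def)
  moreover have "\<one> \<notin> x" if "x \<in> SpecB R" for x
  proof -
    interpret primeideal x "idem_ring R"
      using that by (simp add: SpecB_def)
    show ?thesis
      using one_imp_carrier I_notcarr by (auto simp: idem_ring_def)
  qed
  ultimately show ?thesis
    unfolding SpecB_topology_def topology_generated_by_topspace by blast
qed

end

end

theory Submission
  imports Defs
begin

text \<open>If \<open>x\<close> is a prime ideal of idempotents, then \<open>r \<in> Rx\<close> iff \<open>f r = 0\<close> for some idempotent
  \<open>f \<notin> x\<close>. Hence the infimum of \<open>1\<close> and \<open>1 - a\<close>, which is the largest idempotent \<open>c\<close> with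
  \<open>c a = 0\<close>, cuts out the complement of the support of \<open>a\<close>. For the stalks, if \<open>d\<^sub>x\<close> is a lower
  bound of \<open>a\<^sub>x\<close> and \<open>b\<^sub>x\<close>, then \<open>f d\<close> is a lower bound of \<open>a\<close> and \<open>b\<close> for some idempotent
  \<open>f \<notin> x\<close>, and \<open>(f d)\<^sub>x = d\<^sub>x\<close>; so the germ of the infimum of \<open>a\<close> and \<open>b\<close> is an infimum of
  their germs.\<close>

text \<open>Turns infima into plain equations, for \<open>R\<close> as well as for a stalk;
  equations can be carried along the homomorphism \<open>germ R x\<close>.\<close>

lemma greatest_rr_order_iff:
  fixes R (structure)
  assumes "a \<in> carrier R" "b \<in> carrier R"
  shows "greatest (rr_order R) c (Lower (rr_order R) {a, b}) \<longleftrightarrow>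
    c \<in> carrier R \<and> c \<otimes> c = c \<otimes> a \<and> c \<otimes> c = c \<otimes> b \<and>
    (\<forall>d \<in> carrier R. d \<otimes> d = d \<otimes> a \<longrightarrow> d \<otimes> d = d \<otimes> b \<longrightarrow> d \<otimes> d = d \<otimes> c)"
proof -
  have car: "carrier (rr_order R) = carrier R"
    and le: "u \<sqsubseteq>\<^bsub>rr_order R\<^esub> v \<longleftrightarrow> u \<otimes> u = u \<otimes> v" for u v
    by (simp_all add: rr_order_def)
  have lower: "d \<in> Lower (rr_order R) {a, b} \<longleftrightarrow>
      d \<in> carrier R \<and> d \<otimes> d = d \<otimes> a \<and> d \<otimes> d = d \<otimes> b" for d
    unfolding Lower_def car le using assms by blast
  show ?thesis
    unfolding greatest_def Ball_def lower le using Lower_closed[of "rr_order R" "{a, b}"]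
    unfolding car by blast
qed

lemma (in abelian_group) minus_eq_zero_iff:
  assumes "a \<in> carrier G" "b \<in> carrier G"
  shows "a \<ominus> b = \<zero> \<longleftrightarrow> a = b"
  using assms minus_equality[of a "\<ominus> b"] by (auto simp: minus_eq r_neg)

section \<open>Idempotents and prime ideals of their boolean ring\<close>

context reduced_ring
begin

lemma idem_ring_carrier: "e \<in> carrier (idem_ring R) \<longleftrightarrow> e \<in> carrier R \<and> e \<otimes> e = e"
  by (simp add: idem_ring_def)

lemma idem_compl:
  assumes "e \<in> carrier (idem_ring R)"
  shows "\<one> \<ominus> e \<in> carrier (idem_ring R)" "e \<otimes> (\<one> \<ominus> e) = \<zero>" "(\<one> \<ominus> e) \<otimes> e = \<zero>"
    "e \<oplus>\<^bsub>idem_ring R\<^esub> (\<one> \<ominus> e) = \<one>"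
proof -
  have e: "e \<in> carrier R" "e \<otimes> e = e"
    using assms by (auto simp: idem_ring_carrier)
  show z: "e \<otimes> (\<one> \<ominus> e) = \<zero>" "(\<one> \<ominus> e) \<otimes> e = \<zero>"
    using e by (simp_all add: minus_eq l_distr r_distr l_minus r_minus r_neg)
  have "(\<one> \<ominus> e) \<otimes> (\<one> \<ominus> e) = (\<one> \<ominus> e) \<oplus> \<ominus> (e \<otimes> (\<one> \<ominus> e))"
    using e(1) l_distr[of \<one> "\<ominus> e" "\<one> \<ominus> e"] by (simp add: minus_eq l_minus)
  then show "\<one> \<ominus> e \<in> carrier (idem_ring R)"
    using e z by (simp add: idem_ring_carrier)
  \<comment> \<open>The correction term in the boolean sum is twice the product of \<open>e\<close>
    and \<open>\<one> \<ominus> e\<close>, hence zero.\<close>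
  show "e \<oplus>\<^bsub>idem_ring R\<^esub> (\<one> \<ominus> e) = \<one>"
    using e z a_lcomm[of e \<one> "\<ominus> e"] by (simp add: idem_ring_def minus_eq r_neg)
qed

lemma idem_mult:
  assumes "e \<in> carrier (idem_ring R)" "f \<in> carrier (idem_ring R)"
  shows "e \<otimes> f \<in> carrier (idem_ring R)"
proof -
  interpret B: cring "idem_ring R" by (rule idem_ring_cring)
  show ?thesis
    using B.m_closed[OF assms] by (simp add: idem_ring_def)
qed

lemma SpecB_subset: "x \<in> SpecB R \<Longrightarrow> x \<subseteq> carrier (idem_ring R)"
  unfolding SpecB_def
  by (auto dest!: primeideal.axioms(1) ideal.axioms(1) additive_subgroup.a_subset)

lemma SpecB_prime:
  assumes "x \<in> SpecB R" "e \<in> carrier (idem_ring R)" "f \<in> carrier (idem_ring R)"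
    and "e \<notin> x" "f \<notin> x"
  shows "e \<otimes> f \<notin> x"
  using assms primeideal.I_prime[of x "idem_ring R" e f] by (auto simp: SpecB_def idem_ring_def)

lemma SpecB_proper:
  assumes "x \<in> SpecB R"
  shows "\<one> \<notin> x"
proof -
  interpret primeideal x "idem_ring R"
    using assms by (simp add: SpecB_def)
  show ?thesis
    using one_imp_carrier I_notcarr by (auto simp: idem_ring_def)
qed

text \<open>The product of \<open>e\<close> and \<open>\<one> \<ominus> e\<close> is zero, so
  primeness puts one of them in \<open>x\<close>. Their boolean sum is \<open>\<one>\<close>, which
  is not in \<open>x\<close>, so they cannot both be there.\<close>

lemma SpecB_compl_iff:
  assumes x: "x \<in> SpecB R" and e: "e \<in> carrier (idem_ring R)"
  shows "\<one> \<ominus> e \<in> x \<longleftrightarrow> e \<notin> x"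
proof -
  have sub: "additive_subgroup x (idem_ring R)"
    using x by (auto simp: SpecB_def dest: primeideal.axioms(1) ideal.axioms(1))
  have "\<zero> \<in> x"
    using additive_subgroup.zero_closed[OF sub] by (simp add: idem_ring_def)
  then have "\<one> \<ominus> e \<in> x \<or> e \<in> x"
    using SpecB_prime[OF x e idem_compl(1)[OF e]] idem_compl(2)[OF e] by auto
  moreover have "\<not> (\<one> \<ominus> e \<in> x \<and> e \<in> x)"
    using additive_subgroup.a_closed[OF sub, of e "\<one> \<ominus> e"] idem_compl(4)[OF e] SpecB_proper[OF x] by auto
  ultimately show ?thesis by blast
qed

section \<open>Pierce ideals and annihilating idempotents\<close>

lemma pierce_ideal_ideal:
  assumes "x \<in> SpecB R"
  shows "ideal (pierce_ideal R x) R"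
  unfolding pierce_ideal_def
  using SpecB_subset[OF assms] by (intro genideal_ideal) (auto simp: idem_ring_carrier)

text \<open>Prepares the use of minimality of the ideal generated by \<open>x\<close>. Annihilators
  \<open>f\<close> of \<open>r\<close> and \<open>g\<close> of \<open>s\<close> combine to
  \<open>f \<otimes> g\<close>, which stays outside \<open>x\<close> by primeness; centrality lets
  \<open>f\<close> pass a factor on the left of \<open>r\<close>.\<close>

lemma idem_annihilated_ideal:
  assumes x: "x \<in> SpecB R"
  shows "ideal {r \<in> carrier R. \<exists>f \<in> carrier (idem_ring R) - x. f \<otimes> r = \<zero>} R"
    (is "ideal ?I R")
proof (rule idealI)
  show "subgroup ?I (add_monoid R)"
  proof (rule add.subgroupI)
    have "\<zero> \<in> ?I"
      using SpecB_proper[OF x] by (auto simp: idem_ring_carrier intro!: bexI[of _ \<one>])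
    then show "?I \<noteq> {}"
      by blast
  next
    fix r assume "r \<in> ?I"
    then show "\<ominus> r \<in> ?I"
      by (auto simp: idem_ring_carrier r_minus)
  next
    fix r s assume "r \<in> ?I" "s \<in> ?I"
    then obtain f g where f: "f \<in> carrier (idem_ring R)" "f \<notin> x" "f \<otimes> r = \<zero>"
      and g: "g \<in> carrier (idem_ring R)" "g \<notin> x" "g \<otimes> s = \<zero>"
      and rs: "r \<in> carrier R" "s \<in> carrier R"
      by auto
    have c: "f \<in> carrier R" "g \<in> carrier R"
      using f g by (auto simp: idem_ring_carrier)
    have "f \<otimes> g \<otimes> r = \<zero>"
      using c rs f(1,3) g(1) idem_central[of f g] by (simp add: idem_ring_carrier m_assoc)
    moreover have "f \<otimes> g \<otimes> s = \<zero>"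
      using c rs g(3) by (simp add: m_assoc)
    ultimately have "f \<otimes> g \<otimes> (r \<oplus> s) = \<zero>"
      using c rs by (simp add: r_distr)
    moreover have "f \<otimes> g \<in> carrier (idem_ring R) - x"
      using idem_mult[OF f(1) g(1)] SpecB_prime[OF x f(1) g(1) f(2) g(2)] by blast
    ultimately show "r \<oplus> s \<in> ?I"
      using rs by blast
  qed auto
next
  fix r s assume "r \<in> ?I" and s: "s \<in> carrier R"
  then obtain f where f: "f \<in> carrier (idem_ring R)" "f \<notin> x" "f \<otimes> r = \<zero>"
    and r: "r \<in> carrier R"
    by auto
  have c: "f \<in> carrier R"
    using f by (auto simp: idem_ring_carrier)
  have "f \<otimes> (r \<otimes> s) = \<zero>"
    using c r s f(3) by (simp flip: m_assoc)
  then show "r \<otimes> s \<in> ?I"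
    using f r s by auto
  have "f \<otimes> (s \<otimes> r) = s \<otimes> (f \<otimes> r)"
    using c r s f(1) idem_central[of f s] by (simp add: idem_ring_carrier flip: m_assoc)
  then show "s \<otimes> r \<in> ?I"
    using f r s by auto
qed (rule ring_axioms)

lemma pierce_ideal_iff:
  assumes x: "x \<in> SpecB R" and r: "r \<in> carrier R"
  shows "r \<in> pierce_ideal R x \<longleftrightarrow> (\<exists>f \<in> carrier (idem_ring R) - x. f \<otimes> r = \<zero>)"
proof
  assume "r \<in> pierce_ideal R x"
  \<comment> \<open>The generators satisfy the condition: \<open>e\<close> is annihilated by
    \<open>\<one> \<ominus> e\<close>, which is not in \<open>x\<close>.\<close>
  moreover have "e \<in> carrier R \<and> (\<exists>f \<in> carrier (idem_ring R) - x. f \<otimes> e = \<zero>)" if "e \<in> x" for e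
  proof -
    have e: "e \<in> carrier (idem_ring R)"
      using SpecB_subset[OF x] that by blast
    show ?thesis
      using e idem_compl[OF e] SpecB_compl_iff[OF x e] that by (auto simp: idem_ring_carrier)
  qed
  ultimately show "\<exists>f \<in> carrier (idem_ring R) - x. f \<otimes> r = \<zero>"
    using genideal_minimal[OF idem_annihilated_ideal[OF x], of x]
    by (auto simp: pierce_ideal_def)
next
  assume "\<exists>f \<in> carrier (idem_ring R) - x. f \<otimes> r = \<zero>"
  then obtain f where f: "f \<in> carrier (idem_ring R)" "f \<notin> x" "f \<otimes> r = \<zero>"
    by blast
  interpret ideal "pierce_ideal R x" R
    by (rule pierce_ideal_ideal[OF x])
  have "x \<subseteq> pierce_ideal R x"
    unfolding pierce_ideal_def
    using SpecB_subset[OF x] by (intro genideal_self) (auto simp: idem_ring_carrier)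
  \<comment> \<open>Since \<open>f\<close> annihilates \<open>r\<close>, \<open>r\<close> is its own
    multiple by \<open>\<one> \<ominus> f\<close>, an element of \<open>x\<close>.\<close>
  then have "\<one> \<ominus> f \<in> pierce_ideal R x"
    using SpecB_compl_iff[OF x f(1)] f(2) by blast
  then have "(\<one> \<ominus> f) \<otimes> r \<in> pierce_ideal R x"
    using r by (rule I_r_closed)
  moreover have "(\<one> \<ominus> f) \<otimes> r = r"
    using f r by (simp add: idem_ring_carrier minus_eq l_distr l_minus)
  ultimately show "r \<in> pierce_ideal R x"
    by simp
qed

section \<open>Germs and Pierce stalks\<close>

lemma germ_eq_zero_iff:
  assumes x: "x \<in> SpecB R" and r: "r \<in> carrier R"
  shows "germ R x r = \<zero>\<^bsub>pierce_stalk R x\<^esub> \<longleftrightarrow> (\<exists>f \<in> carrier (idem_ring R) - x. f \<otimes> r = \<zero>)"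
proof -
  interpret ideal "pierce_ideal R x" R
    by (rule pierce_ideal_ideal[OF x])
  have "germ R x r = \<zero>\<^bsub>pierce_stalk R x\<^esub> \<longleftrightarrow> r \<in> pierce_ideal R x"
    using a_rcos_self[OF r] a_rcos_const
    by (auto simp: germ_def pierce_stalk_def FactRing_def)
  then show ?thesis
    using pierce_ideal_iff[OF x r] by simp
qed

lemma germ_ring_hom: "x \<in> SpecB R \<Longrightarrow> ring_hom_ring R (pierce_stalk R x) (germ R x)"
  unfolding pierce_stalk_def germ_def
  by (intro ideal.rcos_ring_hom_ring pierce_ideal_ideal)

lemma pierce_stalk_carrier: "carrier (pierce_stalk R x) = germ R x ` carrier R"
  by (auto simp: pierce_stalk_def germ_def FactRing_def A_RCOSETS_def')

text \<open>Apply \<open>germ_eq_zero_iff\<close> to \<open>r \<ominus> s\<close>. The idempotent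
  \<open>f\<close> marks a basic neighbourhood of \<open>x\<close>, the primes not containing
  \<open>f\<close>, on which the germs of \<open>r\<close> and \<open>s\<close> agree.\<close>

lemma germ_eq_iff:
  assumes x: "x \<in> SpecB R" and r: "r \<in> carrier R" and s: "s \<in> carrier R"
  shows "germ R x r = germ R x s \<longleftrightarrow> (\<exists>f \<in> carrier (idem_ring R) - x. f \<otimes> r = f \<otimes> s)"
proof -
  interpret h: ring_hom_ring R "pierce_stalk R x" "germ R x"
    by (rule germ_ring_hom[OF x])
  have "germ R x r = germ R x s \<longleftrightarrow> germ R x (r \<ominus> s) = \<zero>\<^bsub>pierce_stalk R x\<^esub>"
    using r s h.S.minus_eq_zero_iff[of "germ R x r" "germ R x s"] by (simp add: minus_eq h.S.minus_eq)
  moreover have "f \<otimes> (r \<ominus> s) = \<zero> \<longleftrightarrow> f \<otimes> r = f \<otimes> s" if "f \<in> carrier (idem_ring R)" for f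
  proof -
    have "f \<otimes> (r \<ominus> s) = f \<otimes> r \<ominus> f \<otimes> s"
      using that r s by (simp add: idem_ring_carrier minus_eq r_distr r_minus)
    then show ?thesis
      using that r s by (simp add: idem_ring_carrier minus_eq_zero_iff)
  qed
  ultimately show ?thesis
    using germ_eq_zero_iff[OF x, of "r \<ominus> s"] r s by auto
qed

text \<open>If the germ of \<open>r\<close> is nilpotent, some idempotent \<open>f\<close> outside
  \<open>x\<close> annihilates a power of \<open>r\<close>. By centrality
  \<open>f \<otimes> r\<close> is then nilpotent in \<open>R\<close>, hence zero, so the germ
  vanishes.\<close>

lemma pierce_stalk_reduced:
  assumes x: "x \<in> SpecB R"
  shows "reduced_ring (pierce_stalk R x)"
proof -
  interpret h: ring_hom_ring R "pierce_stalk R x" "germ R x"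
    by (rule germ_ring_hom[OF x])
  show ?thesis
  proof unfold_locales
    fix t and n :: nat
    assume t: "t \<in> carrier (pierce_stalk R x)" and n: "0 < n"
      and tn: "t [^]\<^bsub>pierce_stalk R x\<^esub> n = \<zero>\<^bsub>pierce_stalk R x\<^esub>"
    obtain r where r: "r \<in> carrier R" and t_eq: "t = germ R x r"
      using t by (auto simp: pierce_stalk_carrier)
    have "germ R x (r [^] n) = \<zero>\<^bsub>pierce_stalk R x\<^esub>"
      using tn r by (simp add: t_eq h.hom_nat_pow)
    then obtain f where f: "f \<in> carrier (idem_ring R) - x" "f \<otimes> r [^] n = \<zero>"
      using germ_eq_zero_iff[OF x, of "r [^] n"] r by auto
    have fc: "f \<in> carrier R" "f \<otimes> f = f"
      using f by (auto simp: idem_ring_carrier)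
    \<comment> \<open>A positive exponent leaves one factor \<open>f\<close> next to
      \<open>r [^] n\<close>.\<close>
    obtain m where m: "n = Suc m"
      using n gr0_implies_Suc by blast
    have "(f \<otimes> r) [^] n = f [^] n \<otimes> r [^] n"
      using fc r idem_central by (intro pow_mult_distrib) auto
    also have "\<dots> = f [^] m \<otimes> (f \<otimes> r [^] n)"
      using fc r by (simp add: m m_assoc)
    also have "\<dots> = \<zero>"
      using f fc by simp
    finally have "f \<otimes> r = \<zero>"
      using nilpotent_zero n fc r by auto
    then show "t = \<zero>\<^bsub>pierce_stalk R x\<^esub>"
      using germ_eq_zero_iff[OF x r] f by (auto simp: t_eq)
  qed
qed

section \<open>Basic clopen sets of the spectrum\<close>

lemma SpecB_basic_open:
  assumes "e \<in> carrier (idem_ring R)"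
  shows "openin (SpecB_topology R) {x \<in> SpecB R. e \<notin> x}"
  unfolding SpecB_topology_def using assms by (intro topology_generated_by_Basis) auto

text \<open>The complement is the basic open set of the idempotent
  \<open>\<one> \<ominus> e\<close>.\<close>

lemma SpecB_basic_closed:
  assumes e: "e \<in> carrier (idem_ring R)"
  shows "closedin (SpecB_topology R) {x \<in> SpecB R. e \<notin> x}"
proof -
  have "SpecB R - {x \<in> SpecB R. e \<notin> x} = {x \<in> SpecB R. \<one> \<ominus> e \<notin> x}"
    using SpecB_compl_iff[OF _ e] by auto
  then show ?thesis
    using SpecB_basic_open[OF idem_compl(1)[OF e]] by (auto simp: closedin_def topspace_SpecB)
qed

end

section \<open>Supports in an rr-good ring\<close>

context rr_good_ring
begin

text \<open>Being below \<open>\<one>\<close> in the rr-order means being idempotent, and an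
  idempotent is below \<open>\<one> \<ominus> a\<close> iff it annihilates \<open>a\<close>. So the
  lower bounds of this pair are the annihilating idempotents, and for these
  \<open>f \<otimes> c = f\<close> says that \<open>f\<close> is below \<open>c\<close>.\<close>

lemma largest_annihilating_idem:
  assumes a: "a \<in> carrier R"
  shows "\<exists>c \<in> carrier (idem_ring R). c \<otimes> a = \<zero> \<and>
    (\<forall>f \<in> carrier (idem_ring R). f \<otimes> a = \<zero> \<longrightarrow> f \<otimes> c = f)"
proof -
  have ann: "f \<otimes> (\<one> \<ominus> a) = f \<longleftrightarrow> f \<otimes> a = \<zero>" if "f \<in> carrier R" for f
  proof -
    have "f \<otimes> (\<one> \<ominus> a) = f \<ominus> f \<otimes> a"
      using that a by (simp add: minus_eq r_distr r_minus)
    then show ?thesis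
      using that a add.r_cancel_one[of f "\<ominus> (f \<otimes> a)"] add.inv_eq_1_iff[of "f \<otimes> a"]
      by (simp add: minus_eq)
  qed
  obtain c where c: "greatest (rr_order R) c (Lower (rr_order R) {\<one>, \<one> \<ominus> a})"
    using rr_inf_exists[of \<one> "\<one> \<ominus> a"] a by auto
  have c1: "c \<in> carrier R" "c \<otimes> c = c \<otimes> \<one>" "c \<otimes> c = c \<otimes> (\<one> \<ominus> a)"
    and max: "\<And>d. \<lbrakk>d \<in> carrier R; d \<otimes> d = d \<otimes> \<one>; d \<otimes> d = d \<otimes> (\<one> \<ominus> a)\<rbrakk>
      \<Longrightarrow> d \<otimes> d = d \<otimes> c"
    using c unfolding greatest_rr_order_iff[OF one_closed minus_closed[OF one_closed a]]
    by blast+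
  have c2: "c \<otimes> c = c" "c \<otimes> (\<one> \<ominus> a) = c"
    using c1 by (metis r_one)+
  have "c \<in> carrier (idem_ring R)" "c \<otimes> a = \<zero>"
    using c1(1) c2 ann[of c] by (auto simp: idem_ring_carrier)
  moreover have "f \<otimes> c = f" if "f \<in> carrier (idem_ring R)" "f \<otimes> a = \<zero>" for f
    using that max[of f] ann[of f] by (metis idem_ring_carrier r_one)
  ultimately show ?thesis
    by blast
qed

lemma pierce_supp_clopen:
  assumes a: "a \<in> carrier R"
  shows "openin (SpecB_topology R) (pierce_supp R a)"
    and "closedin (SpecB_topology R) (pierce_supp R a)"
proof -
  obtain c where c: "c \<in> carrier (idem_ring R)" "c \<otimes> a = \<zero>"
    and max: "\<And>f. \<lbrakk>f \<in> carrier (idem_ring R); f \<otimes> a = \<zero>\<rbrakk> \<Longrightarrow> f \<otimes> c = f"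
    using largest_annihilating_idem[OF a] by blast
  \<comment> \<open>If \<open>c\<close> is outside \<open>x\<close>, it is itself the required
    annihilator. If \<open>c\<close> is in \<open>x\<close>, so is every annihilating
    \<open>f\<close>, being a multiple of \<open>c\<close>.\<close>
  have "germ R x a = \<zero>\<^bsub>pierce_stalk R x\<^esub> \<longleftrightarrow> c \<notin> x" if x: "x \<in> SpecB R" for x
  proof -
    interpret primeideal x "idem_ring R"
      using x by (simp add: SpecB_def)
    have "f \<in> x" if "f \<in> carrier (idem_ring R)" "f \<otimes> a = \<zero>" "c \<in> x" for f
      using I_l_closed[OF that(3,1)] max[OF that(1,2)] by (simp add: idem_ring_def)
    then show ?thesis
      using c germ_eq_zero_iff[OF x a] by auto
  qed
  \<comment> \<open>The support consists of the primes containing \<open>c\<close>; passing to the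
    complement gives it the shape of a basic clopen set.\<close>
  then have "pierce_supp R a = {x \<in> SpecB R. \<one> \<ominus> c \<notin> x}"
    using SpecB_compl_iff[OF _ c(1)] by (auto simp: pierce_supp_def)
  then show "openin (SpecB_topology R) (pierce_supp R a)"
    "closedin (SpecB_topology R) (pierce_supp R a)"
    using SpecB_basic_open SpecB_basic_closed idem_compl(1)[OF c(1)] by simp_all
qed

section \<open>Infima in the stalks\<close>

lemma germ_inf:
  assumes x: "x \<in> SpecB R" and a: "a \<in> carrier R" and b: "b \<in> carrier R"
    and c: "greatest (rr_order R) c (Lower (rr_order R) {a, b})"
  shows "greatest (rr_order (pierce_stalk R x)) (germ R x c)
    (Lower (rr_order (pierce_stalk R x)) {germ R x a, germ R x b})"
proof -
  let ?S = "pierce_stalk R x"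
  interpret h: ring_hom_ring R ?S "germ R x"
    by (rule germ_ring_hom[OF x])
  have cc: "c \<in> carrier R" "c \<otimes> c = c \<otimes> a" "c \<otimes> c = c \<otimes> b"
    and max: "\<And>d. \<lbrakk>d \<in> carrier R; d \<otimes> d = d \<otimes> a; d \<otimes> d = d \<otimes> b\<rbrakk> \<Longrightarrow> d \<otimes> d = d \<otimes> c"
    using c unfolding greatest_rr_order_iff[OF a b] by blast+
  have le_iff: "germ R x d \<otimes>\<^bsub>?S\<^esub> germ R x d = germ R x d \<otimes>\<^bsub>?S\<^esub> germ R x r \<longleftrightarrow>
      (\<exists>f \<in> carrier (idem_ring R) - x. f \<otimes> (d \<otimes> d) = f \<otimes> (d \<otimes> r))"
    if "d \<in> carrier R" "r \<in> carrier R" for d r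
    using germ_eq_iff[OF x, of "d \<otimes> d" "d \<otimes> r"] that by simp
  have "germ R x d \<otimes>\<^bsub>?S\<^esub> germ R x d = germ R x d \<otimes>\<^bsub>?S\<^esub> germ R x c"
    if d: "d \<in> carrier R"
      and da: "germ R x d \<otimes>\<^bsub>?S\<^esub> germ R x d = germ R x d \<otimes>\<^bsub>?S\<^esub> germ R x a"
      and db: "germ R x d \<otimes>\<^bsub>?S\<^esub> germ R x d = germ R x d \<otimes>\<^bsub>?S\<^esub> germ R x b" for d
  proof -
    obtain g h where g: "g \<in> carrier (idem_ring R)" "g \<notin> x" "g \<otimes> (d \<otimes> d) = g \<otimes> (d \<otimes> a)"
      and h: "h \<in> carrier (idem_ring R)" "h \<notin> x" "h \<otimes> (d \<otimes> d) = h \<otimes> (d \<otimes> b)"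
      using iffD1[OF le_iff[OF d a] da] iffD1[OF le_iff[OF d b] db] by blast
    \<comment> \<open>One idempotent for both equations; primeness keeps it outside
      \<open>x\<close>. The order of its factors is swapped below so that either equation can be
      applied to the inner factor.\<close>
    define f where "f = g \<otimes> h"
    have f: "f \<in> carrier (idem_ring R)" "f \<notin> x"
      using g h idem_mult SpecB_prime[OF x] by (auto simp: f_def)
    have fc: "f \<in> carrier R" "f \<otimes> f = f" and gc: "g \<in> carrier R" and hc: "h \<in> carrier R"
      using f g h by (auto simp: idem_ring_carrier)
    have f': "f = h \<otimes> g"
      using g(1) hc idem_central[of g h] by (auto simp: f_def idem_ring_carrier)
    have "f \<otimes> (d \<otimes> d) = f \<otimes> (d \<otimes> a)"
      using g(3) gc hc d a by (simp add: f' m_assoc)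
    moreover have "f \<otimes> (d \<otimes> d) = f \<otimes> (d \<otimes> b)"
      using h(3) gc hc d b by (simp add: f_def m_assoc)
    moreover have ff: "f \<otimes> d \<otimes> (f \<otimes> d) = f \<otimes> (d \<otimes> d)"
    proof -
      have "f \<otimes> d \<otimes> (f \<otimes> d) = f \<otimes> (d \<otimes> f) \<otimes> d"
        using fc(1) d by (simp add: m_assoc)
      also have "\<dots> = f \<otimes> f \<otimes> (d \<otimes> d)"
        using fc(1) d by (simp add: m_assoc flip: idem_central[OF fc d])
      finally show ?thesis
        using fc(2) by simp
    qed
    \<comment> \<open>By \<open>ff\<close> the two equations say that \<open>f \<otimes> d\<close>
      is a lower bound of \<open>a\<close> and \<open>b\<close> in \<open>R\<close> itself, so it
      lies below \<open>c\<close>.\<close>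
    ultimately have "f \<otimes> d \<otimes> (f \<otimes> d) = f \<otimes> d \<otimes> c"
      using fc(1) d a b by (intro max) (simp_all only: m_assoc m_closed)
    then have "f \<otimes> (d \<otimes> d) = f \<otimes> (d \<otimes> c)"
      using fc(1) d cc(1) by (simp only: ff m_assoc)
    then show ?thesis
      using le_iff[OF d cc(1)] f by blast
  qed
  \<comment> \<open>A ring homomorphism preserves the equations defining the rr-order, so the germ
    of \<open>c\<close> is a lower bound.\<close>
  moreover have "germ R x c \<otimes>\<^bsub>?S\<^esub> germ R x c = germ R x c \<otimes>\<^bsub>?S\<^esub> germ R x a"
    "germ R x c \<otimes>\<^bsub>?S\<^esub> germ R x c = germ R x c \<otimes>\<^bsub>?S\<^esub> germ R x b"
    using arg_cong[OF cc(2), of "germ R x"] arg_cong[OF cc(3), of "germ R x"] cc(1) a b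
    by simp_all
  ultimately show ?thesis
    unfolding greatest_rr_order_iff[OF h.hom_closed[OF a] h.hom_closed[OF b]]
    using h.hom_closed[OF cc(1)] by (unfold pierce_stalk_carrier) blast
qed

lemma pierce_stalk_rr_good:
  assumes x: "x \<in> SpecB R"
  shows "rr_good_ring (pierce_stalk R x)"
proof -
  interpret S: reduced_ring "pierce_stalk R x"
    by (rule pierce_stalk_reduced[OF x])
  show ?thesis
  proof unfold_locales
    fix s t assume "s \<in> carrier (pierce_stalk R x)" "t \<in> carrier (pierce_stalk R x)"
    \<comment> \<open>Every element of the stalk is a germ, so \<open>germ_inf\<close> covers all
      pairs.\<close>
    then obtain a b where "a \<in> carrier R" "b \<in> carrier R" "s = germ R x a" "t = germ R x b"
      by (auto simp: pierce_stalk_carrier)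
    then show "\<exists>c. greatest (rr_order (pierce_stalk R x)) c
        (Lower (rr_order (pierce_stalk R x)) {s, t})"
      using rr_inf_exists germ_inf[OF x] by blast
  qed
qed

end

theorem corollary5p2:
  fixes R :: "('a, 'b) ring_scheme" (structure)
  assumes "rr_good_ring R"
  shows "(\<forall>a \<in> carrier R. openin (SpecB_topology R) (pierce_supp R a)
                        \<and> closedin (SpecB_topology R) (pierce_supp R a))
       \<and> (\<forall>x \<in> SpecB R. rr_good_ring (pierce_stalk R x))"
  using rr_good_ring.pierce_supp_clopen[OF assms] rr_good_ring.pierce_stalk_rr_good[OF assms]
  by blast

end
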